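(* Let $0<p<1/2$, and let $Y$ be the genuine cumulative coefficient and $Y^*$ the simulated cumulative coefficient. Then $$\Pr[Y=\pm2]=p^2,\quad \Pr[Y=\pm1]=2p(1-2p),\quad \Pr[Y=0]=1-4p+6p^2,$$ (each displayed probability with $\pm$ being that of each single value), and the total variation distance between $Y$ and $Y^*$ is exactly $$\Delta(Y,Y^* )=\frac{2(10p^2-6p+1)}{3}=\frac{20}{3}\Bigl(p-\frac3{10}\Bigr)^2+\frac1{15}\ \ge\ \frac1{15},$$ with equality in the last inequality if and only if $p=3/10$. In particular no parameter $p\in(0,1/2)$ makes the simulated law equal to the genuine law.
   Context: A ternary coefficient $X$ with parameter $p$ has $\Pr[X=1]=\Pr[X=-1]=p$ and $\Pr[X=0]=1-2p$. The genuine cumulative coefficient is $Y=X_1+X_2$ with $X_1,X_2$ independent ternary coefficients with parameter $p$. The simulated coefficient $Y^*$ is obtained by sampling $Y$, setting $Y^*=Y$ if $Y\in\{-2,2\}$, and otherwise drawing $Y^*$ uniformly from $\{-1,0,1\}$; thus $\Pr[Y^*=2]=\Pr[Y^*=-2]=p^2$ and $\Pr[Y^*=-1]=\Pr[Y^*=0]=\Pr[Y^*=1]=(1-2p^2)/3$. Total variation distance is $\Delta(Y,Y^* )=\frac12\sum_v|\Pr[Y=v]-\Pr[Y^*=v]|$. (In the e-voting protocol under study, $Y$ is a coefficient of the randomness in a genuine receipt and $Y^*$ a coefficient in a fake receipt.) *)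

theory Defs
  imports "HOL-Probability.Probability"
begin

text \<open>The list below is a well-formed distribution exactly when \<open>0 \<le> p \<le> 1/2\<close>;
  for other \<open>p\<close> the value of \<open>ternary p\<close> is meaningless.\<close>
definition ternary :: "real \<Rightarrow> int pmf" where
  "ternary p = pmf_of_list [(1, p), (-1, p), (0, 1 - 2 * p)]"

lemma pmf_ternary:
  assumes "0 \<le> p" "p \<le> 1 / 2"
  shows "pmf (ternary p) 1 = p" "pmf (ternary p) (-1) = p" "pmf (ternary p) 0 = 1 - 2 * p"
proof -
  have "pmf_of_list_wf [(1::int, p), (-1, p), (0, 1 - 2 * p)]"
    using assms by (intro pmf_of_list_wfI) auto
  then show "pmf (ternary p) 1 = p" "pmf (ternary p) (-1) = p" "pmf (ternary p) 0 = 1 - 2 * p"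
    by (simp_all add: ternary_def pmf_pmf_of_list)
qed

definition genuine :: "real \<Rightarrow> int pmf" where
  "genuine p = map_pmf (\<lambda>(x1, x2). x1 + x2) (pair_pmf (ternary p) (ternary p))"

definition simulated :: "real \<Rightarrow> int pmf" where
  "simulated p = bind_pmf (genuine p)
     (\<lambda>y. if y \<in> {-2, 2} then return_pmf y else pmf_of_set {-1, 0, 1})"

text \<open>The sum always converges: it is dominated by the sum of the two mass functions.\<close>
definition tv_dist :: "'a pmf \<Rightarrow> 'a pmf \<Rightarrow> real" where
  "tv_dist P Q = 1 / 2 * (\<Sum>\<^sub>\<infinity>v. \<bar>pmf P v - pmf Q v\<bar>)"

end

theory Submission
  imports Defs
begin

text \<open>Resampling conditioned on \<open>{-1, 0, 1}\<close> leaves the mass of \<open>\<plusminus>2\<close> alone and averages the rest.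
  With \<open>q = 10 p\<^sup>2 - 6 p + 1\<close>, the differences of the masses are \<open>-q/3\<close> at \<open>\<plusminus>1\<close> and \<open>2 q/3\<close> at \<open>0\<close>,
  and \<open>q\<close> is positive since its discriminant is \<open>-4\<close>.\<close>

text \<open>Conditioning on the first summand makes the law of the sum a mixture, weighted by
  \<open>P\<close>, of translates of \<open>Q\<close>. The finite set \<open>A\<close> turns the
  resulting expectation into a finite convolution sum.\<close>

lemma pmf_map_plus_pair_pmf:
  fixes P Q :: "'a :: ab_group_add pmf"
  assumes "finite A" "set_pmf P \<subseteq> A"
  shows "pmf (map_pmf (\<lambda>(x, y). x + y) (pair_pmf P Q)) v = (\<Sum>x\<in>A. pmf P x * pmf Q (v - x))"
proof -
  \<comment> \<open>Translation by \<open>x\<close> is injective and sends \<open>v - x\<close> to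
    \<open>v\<close>.\<close>
  have shift: "pmf (map_pmf ((+) x) Q) v = pmf Q (v - x)" for x
    using pmf_map_inj'[of "(+) x" Q "v - x"] by simp
  have "map_pmf (\<lambda>(x, y). x + y) (pair_pmf P Q) = bind_pmf P (\<lambda>x. map_pmf ((+) x) Q)"
    by (simp add: pair_pmf_def map_bind_pmf map_pmf_def bind_assoc_pmf bind_return_pmf)
  then have "pmf (map_pmf (\<lambda>(x, y). x + y) (pair_pmf P Q)) v
      = measure_pmf.expectation P (\<lambda>x. pmf Q (v - x))"
    by (simp add: pmf_bind shift)
  also have "\<dots> = (\<Sum>x\<in>A. pmf Q (v - x) * pmf P x)"
    using assms by (intro integral_measure_pmf_real) auto
  finally show ?thesis
    by (simp add: mult.commute)
qed

text \<open>Terms outside \<open>A\<close> vanish because neither law has mass there.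
  \<open>A\<close> may exceed both supports, so one explicit set can serve for two laws.\<close>

lemma tv_dist_finite:
  assumes "finite A" "set_pmf P \<subseteq> A" "set_pmf Q \<subseteq> A"
  shows "tv_dist P Q = 1 / 2 * (\<Sum>v\<in>A. \<bar>pmf P v - pmf Q v\<bar>)"
proof -
  have "(\<Sum>\<^sub>\<infinity>v. \<bar>pmf P v - pmf Q v\<bar>) = (\<Sum>\<^sub>\<infinity>v\<in>A. \<bar>pmf P v - pmf Q v\<bar>)"
    using assms(2,3) by (intro infsum_cong_neutral) (auto simp: set_pmf_iff subset_iff, metis)
  with assms(1) show ?thesis
    by (simp add: tv_dist_def)
qed

lemma set_pmf_ternary:
  assumes "0 \<le> p" "p \<le> 1 / 2"
  shows "set_pmf (ternary p) \<subseteq> {-1, 0, 1}"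
proof -
  have "pmf_of_list_wf [(1::int, p), (-1, p), (0, 1 - 2 * p)]"
    using assms by (intro pmf_of_list_wfI) auto
  from set_pmf_of_list[OF this] show ?thesis
    by (auto simp: ternary_def)
qed

lemma set_pmf_genuine:
  assumes "0 \<le> p" "p \<le> 1 / 2"
  shows "set_pmf (genuine p) \<subseteq> {-2, -1, 0, 1, 2}"
proof -
  have "x + y \<in> {-2, -1, 0, 1, 2}" if "x \<in> set_pmf (ternary p)" "y \<in> set_pmf (ternary p)" for x y
    using subsetD[OF set_pmf_ternary[OF assms] that(1)] subsetD[OF set_pmf_ternary[OF assms] that(2)]
    by auto
  then show ?thesis
    unfolding genuine_def by auto
qed

text \<open>One pair of summands gives 2, and one gives -2; each of 1 and -1 comes from two pairs
  containing a 0; the value 0 comes from (0, 0), (1, -1) and (-1, 1), with total mass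
  \<open>(1 - 2 * p)\<^sup>2 + 2 * p\<^sup>2\<close>.\<close>

lemma pmf_genuine:
  assumes "0 \<le> p" "p \<le> 1 / 2"
  shows "pmf (genuine p) 2 = p\<^sup>2" "pmf (genuine p) (-2) = p\<^sup>2"
    "pmf (genuine p) 1 = 2 * p * (1 - 2 * p)" "pmf (genuine p) (-1) = 2 * p * (1 - 2 * p)"
    "pmf (genuine p) 0 = 1 - 4 * p + 6 * p\<^sup>2"
proof -
  have conv: "pmf (genuine p) v = (\<Sum>x\<in>{-1, 0, 1}. pmf (ternary p) x * pmf (ternary p) (v - x))" for v
    unfolding genuine_def by (intro pmf_map_plus_pair_pmf set_pmf_ternary assms) simp
  \<comment> \<open>In the convolution, \<open>v - x\<close> can leave the ternary range, as for
    \<open>v = 2\<close> and \<open>x = 0\<close>; those terms must drop out.\<close>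
  have zero: "pmf (ternary p) x = 0" if "x \<notin> {-1, 0, 1}" for x
    using set_pmf_ternary[OF assms] that by (auto simp: set_pmf_iff)
  show "pmf (genuine p) 2 = p\<^sup>2" "pmf (genuine p) (-2) = p\<^sup>2"
    "pmf (genuine p) 1 = 2 * p * (1 - 2 * p)" "pmf (genuine p) (-1) = 2 * p * (1 - 2 * p)"
    "pmf (genuine p) 0 = 1 - 4 * p + 6 * p\<^sup>2"
    by (simp_all add: conv zero pmf_ternary[OF assms] power2_eq_square algebra_simps)
qed

lemma set_pmf_simulated:
  assumes "0 \<le> p" "p \<le> 1 / 2"
  shows "set_pmf (simulated p) \<subseteq> {-2, -1, 0, 1, 2}"
  using set_pmf_genuine[OF assms] by (auto simp: simulated_def split: if_splits)

lemma pmf_simulated: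
  assumes "0 \<le> p" "p \<le> 1 / 2"
  shows "v \<in> {-2, 2} \<Longrightarrow> pmf (simulated p) v = p\<^sup>2"
    "v \<in> {-1, 0, 1} \<Longrightarrow> pmf (simulated p) v = (1 - 2 * p\<^sup>2) / 3"
proof -
  let ?K = "\<lambda>y::int. if y \<in> {-2, 2} then return_pmf y else pmf_of_set {-1, 0, 1}"
  \<comment> \<open>Law of total probability over the genuine value \<open>y\<close>. For
    \<open>v\<close> in \<open>{-1, 0, 1}\<close>, each such \<open>y\<close> contributes a third of
    its mass, and these masses total \<open>2 * (2 * p * (1 - 2 * p)) + (1 - 4 * p + 6 * p\<^sup>2)
    = 1 - 2 * p\<^sup>2\<close>.\<close>
  have mix: "pmf (simulated p) v = (\<Sum>y\<in>{-2, -1, 0, 1, 2}. pmf (?K y) v * pmf (genuine p) y)" for v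
    unfolding simulated_def pmf_bind
    using set_pmf_genuine[OF assms] by (intro integral_measure_pmf_real) auto
  show "v \<in> {-2, 2} \<Longrightarrow> pmf (simulated p) v = p\<^sup>2"
    "v \<in> {-1, 0, 1} \<Longrightarrow> pmf (simulated p) v = (1 - 2 * p\<^sup>2) / 3"
    by (auto simp: mix pmf_genuine[OF assms] pmf_return power2_eq_square field_simps)
qed

lemma tv_dist_genuine_simulated:
  assumes "0 \<le> p" "p \<le> 1 / 2"
  shows "tv_dist (genuine p) (simulated p) = 2 * (10 * p\<^sup>2 - 6 * p + 1) / 3"
proof -
  define q where "q = 10 * p\<^sup>2 - 6 * p + 1"
  \<comment> \<open>Completing the square fixes the sign of \<open>q\<close>, which resolves the
    absolute values below.\<close>
  have "q = 10 * (p - 3 / 10)\<^sup>2 + 1 / 10"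
    by (simp add: q_def power2_eq_square algebra_simps)
  then have "q \<ge> 0"
    by simp
  have "2 * p * (1 - 2 * p) - (1 - 2 * p\<^sup>2) / 3 = - (q / 3)"
    "1 - 4 * p + 6 * p\<^sup>2 - (1 - 2 * p\<^sup>2) / 3 = 2 * q / 3"
    by (simp_all add: q_def power2_eq_square field_simps)
  then have "\<bar>2 * p * (1 - 2 * p) - (1 - 2 * p\<^sup>2) / 3\<bar> = q / 3"
    "\<bar>1 - 4 * p + 6 * p\<^sup>2 - (1 - 2 * p\<^sup>2) / 3\<bar> = 2 * q / 3"
    using \<open>q \<ge> 0\<close> by linarith+
  \<comment> \<open>The terms at 2 and -2 cancel; half of \<open>q / 3 + q / 3 + 2 * q / 3\<close>
    remains.\<close>
  then have "tv_dist (genuine p) (simulated p) = 2 * q / 3"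
    by (simp add: tv_dist_finite[OF _ set_pmf_genuine[OF assms] set_pmf_simulated[OF assms]]
        pmf_genuine[OF assms] pmf_simulated[OF assms])
  then show ?thesis
    by (simp add: q_def)
qed

theorem mainTheorem5:
  fixes p :: real
  assumes "0 < p" and "p < 1 / 2"
  shows "pmf (genuine p) 2 = p\<^sup>2 \<and> pmf (genuine p) (-2) = p\<^sup>2
       \<and> pmf (genuine p) 1 = 2 * p * (1 - 2 * p) \<and> pmf (genuine p) (-1) = 2 * p * (1 - 2 * p)
       \<and> pmf (genuine p) 0 = 1 - 4 * p + 6 * p\<^sup>2
       \<and> tv_dist (genuine p) (simulated p) = 2 * (10 * p\<^sup>2 - 6 * p + 1) / 3
       \<and> 2 * (10 * p\<^sup>2 - 6 * p + 1) / 3 = 20 / 3 * (p - 3 / 10)\<^sup>2 + 1 / 15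
       \<and> tv_dist (genuine p) (simulated p) \<ge> 1 / 15
       \<and> (tv_dist (genuine p) (simulated p) = 1 / 15 \<longleftrightarrow> p = 3 / 10)
       \<and> simulated p \<noteq> genuine p"
proof -
  have p: "0 \<le> p" "p \<le> 1 / 2"
    using assms by simp_all
  note tv = tv_dist_genuine_simulated[OF p]
  \<comment> \<open>In this form the bound and its equality case are immediate: the square is
    nonnegative and vanishes only at \<open>p = 3 / 10\<close>.\<close>
  have square: "2 * (10 * p\<^sup>2 - 6 * p + 1) / 3 = 20 / 3 * (p - 3 / 10)\<^sup>2 + 1 / 15"
    by (simp add: power2_eq_square field_simps)
  have lower: "tv_dist (genuine p) (simulated p) \<ge> 1 / 15"
    unfolding tv square by simp
  have equality: "tv_dist (genuine p) (simulated p) = 1 / 15 \<longleftrightarrow> p = 3 / 10"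
    unfolding tv square by simp
  \<comment> \<open>Equal laws would have distance 0, contradicting the lower bound
    \<open>1 / 15\<close>.\<close>
  have "tv_dist (genuine p) (genuine p) = 0"
    by (simp add: tv_dist_def)
  with lower have "simulated p \<noteq> genuine p"
    by auto
  with pmf_genuine[OF p] tv square lower equality show ?thesis
    by blast
qed

end
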